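(* Let $\kappa\leq\lambda\leq\mathfrak c$ be uncountable cardinals. The following are equivalent: (1) $C_9(\lambda,\kappa)$; (2) there is a set $A\subseteq\mathbb N^{\mathbb N}$ of cardinality $\lambda$ and a sequence $g_1\geq g_2\geq\ldots$ of continuous functions $g_n:A\to\mathbb R$ which converges to zero pointwise on $A$ but does not converge uniformly on any subset of $A$ of cardinality $\kappa$; (3) there is a $\kappa$-K-Lusin set of cardinality $\lambda$ in $\mathbb N^{\mathbb N}$; (4) there is a Polish space $X$ and a $\kappa$-K-Lusin set of cardinality $\lambda$ in $X$.
   Context: $\mathfrak c=2^{\aleph_0}$. $\mathbb N^{\mathbb N}$ is the Baire space. For uncountable cardinals $\kappa\leq\lambda\leq\mathfrak c$, $C_9(\lambda,\kappa)$ denotes the statement: there exist a set $E\subseteq\mathbb R$ of cardinality $\lambda$ and a sequence of functions $f_n:E\to\mathbb R$ converging pointwise on $E$ but not converging uniformly on any subset of $E$ of cardinality $\kappa$. For a Polish space $X$ and a cardinal $\aleph_1\leq\kappa\leq\mathfrak c$, an uncountable set $E\subseteq X$ is a $\kappa$-K-Lusin set in $X$ if $|E\cap K|<\kappa$ for every compact set $K\subseteq X$. *)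

theory Defs
  imports "HOL-Analysis.Analysis"
begin

unbundle cardinal_syntax

text \<open>
  Cardinals are represented as in the library by cardinal orders, i.e. relations \<open>r\<close> with
  \<open>Card_order r\<close>, on an arbitrary type. A set \<open>A\<close> has cardinality \<open>r\<close> iff \<open>|A| =o r\<close>.
\<close>

abbreviation continuum :: "(nat \<Rightarrow> bool) rel"
  where "continuum \<equiv> ctwo ^c natLeq"

text \<open>
  The functions \<open>f n\<close> are total functions on the reals, but only their values on \<open>E\<close> matter.
\<close>

definition C9 :: "'l rel \<Rightarrow> 'k rel \<Rightarrow> bool"
  where "C9 \<mu> \<kappa> \<longleftrightarrow>
    (\<exists>(E :: real set) (f :: nat \<Rightarrow> real \<Rightarrow> real).
       |E| =o \<mu> \<and>
       (\<forall>x\<in>E. convergent (\<lambda>n. f n x)) \<and>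
       (\<forall>S\<subseteq>E. |S| =o \<kappa> \<longrightarrow> \<not> uniformly_convergent_on S f))"

definition Polish_space :: "'x topology \<Rightarrow> bool"
  where "Polish_space X \<longleftrightarrow> completely_metrizable_space X \<and> separable_space X"

definition K_Lusin_in :: "'k rel \<Rightarrow> 'x topology \<Rightarrow> 'x set \<Rightarrow> bool"
  where "K_Lusin_in \<kappa> X E \<longleftrightarrow>
    E \<subseteq> topspace X \<and> uncountable E \<and> (\<forall>K. compactin X K \<longrightarrow> |E \<inter> K| <o \<kappa>)"

text \<open>
  The library topology on \<^typ>\<open>nat \<Rightarrow> nat\<close> is the product of the discrete topologies, so this
  is the Baire space.
\<close>

abbreviation Baire_space :: "(nat \<Rightarrow> nat) topology"
  where "Baire_space \<equiv> euclidean"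

text \<open>
  HOL has no quantification over types, so ``there is a Polish space'' must be read as: there is
  a Polish topology \<^typ>\<open>'x topology\<close>, with any subset of the type as its underlying set,
  where \<^typ>\<open>'x\<close> is an arbitrary type of cardinality at least \<^term>\<open>continuum\<close>. Every
  Polish space has at most continuum many points, so up to homeomorphism each one occurs.
\<close>

end

theory Submission
  imports Defs
begin

text \<open>
  A set in Baire space is \<open>\<kappa>\<close>-K-Lusin iff it meets every box \<open>{x. \<forall>k. x k \<le> h k}\<close> in fewer than
  \<open>\<kappa>\<close> points. So (1) and (4) each yield a map \<open>\<phi>\<close> from the given set into Baire space all of whose
  preimages of boxes are small: for (1), \<open>\<phi> x k\<close> is a stage from which \<open>f n x\<close> stays
  \<open>1/(k+1)\<close>-close to its limit, so that the convergence is uniform on preimages of boxes; for (4),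
  \<open>\<phi> x k\<close> is the index of a point of a fixed dense sequence within \<open>1/(k+1)\<close> of \<open>x\<close>, so that
  preimages of boxes are totally bounded. Such a \<open>\<phi>\<close> can be made injective without enlarging
  the preimages of boxes, which gives (3). Conversely, in (3) the functions
  \<open>x \<mapsto> dist x (min x n)\<close> converge uniformly only on subsets of boxes.
\<close>

section \<open>Smallness on boxes, and cardinalities up to the continuum\<close>

text \<open>The map is a parameter so that one condition covers stages of convergence, indices of
  approximating points and, with the identity, the compactness clause of \<open>K_Lusin_in\<close>
  in Baire space.\<close>

definition box_small :: "'k rel \<Rightarrow> ('a \<Rightarrow> nat \<Rightarrow> nat) \<Rightarrow> 'a set \<Rightarrow> bool"
  where "box_small \<kappa> \<phi> E \<longleftrightarrow> (\<forall>h. |{x \<in> E. \<forall>k. \<phi> x k \<le> h k}| <o \<kappa>)"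

lemma continuum_ordIso_nat_sets: "continuum =o |UNIV :: nat set set|"
proof -
  have "continuum = |UNIV :: (nat \<Rightarrow> bool) set|"
    by (simp add: cexp_def ctwo_def Field_card_of Field_natLeq Func_def)
  moreover have "bij_betw Collect (UNIV :: (nat \<Rightarrow> bool) set) UNIV"
    by (rule bij_betwI[where g = "\<lambda>A x. x \<in> A"]) auto
  ultimately show ?thesis
    using card_of_ordIsoI by auto
qed

lemma continuum_ordIso_reals: "continuum =o |UNIV :: real set|"
  using continuum_ordIso_nat_sets nat_sets_eqpoll_reals
  unfolding eqpoll_iff_card_of_ordIso by (rule ordIso_transitive)

text \<open>A function is coded by its graph, which the pairing \<open>to_nat\<close> turns into a
  set of naturals.\<close>

lemma Baire_ordLeq_continuum: "|UNIV :: (nat \<Rightarrow> nat) set| \<le>o continuum"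
proof -
  have "inj (\<lambda>(x :: nat \<Rightarrow> nat). to_nat ` {(k, x k) |k. True})"
  proof (rule injI)
    fix x y :: "nat \<Rightarrow> nat"
    assume "to_nat ` {(k, x k) |k. True} = to_nat ` {(k, y k) |k. True}"
    then have "{(k, x k) |k. True} = {(k, y k) |k. True}"
      by (simp add: inj_image_eq_iff)
    then show "x = y"
      by (auto simp: set_eq_iff fun_eq_iff)
  qed
  then have "|UNIV :: (nat \<Rightarrow> nat) set| \<le>o |UNIV :: nat set set|"
    using card_of_ordLeqI by blast
  then show ?thesis
    by (rule ordLeq_ordIso_trans[OF _ ordIso_symmetric[OF continuum_ordIso_nat_sets]])
qed

text \<open>Used to place sets inside \<open>nat set\<close>, \<open>real\<close> and the type
  \<open>'x\<close>.\<close>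

lemma inj_on_if_ordLeq_continuum:
  fixes A :: "'a set"
  assumes "|A| \<le>o continuum" and "continuum \<le>o |UNIV :: 'b set|"
  obtains f :: "'a \<Rightarrow> 'b" where "inj_on f A"
proof -
  have "|A| \<le>o |UNIV :: 'b set|"
    using assms by (rule ordLeq_transitive)
  then show ?thesis
    using that unfolding card_of_ordLeq[symmetric] by blast
qed

lemma card_of_inj_on_image: "inj_on f A \<Longrightarrow> |f ` A| =o |A|"
  by (meson bij_betw_imageI card_of_ordIsoI ordIso_symmetric)

text \<open>Otherwise \<kappa> \<le> |A|, and then A has a subset of size exactly \<kappa>. This
  links \<open>C9\<close>, which speaks of subsets of size \<kappa>, to the strict bounds in
  \<open>box_small\<close>.\<close>

lemma ordLess_if_no_subset_ordIso:
  fixes A :: "'a set" and \<kappa> :: "'k rel"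
  assumes "Card_order \<kappa>" and "\<And>S. S \<subseteq> A \<Longrightarrow> \<not> |S| =o \<kappa>"
  shows "|A| <o \<kappa>"
proof (rule ccontr)
  assume "\<not> |A| <o \<kappa>"
  then have "\<kappa> \<le>o |A|"
    using assms(1) card_order_on_well_order_on card_of_Well_order ordLess_or_ordLeq by blast
  then have "|Field \<kappa>| \<le>o |A|"
    using assms(1) card_of_Field_ordIso ordIso_ordLeq_trans by blast
  then obtain B where "B \<subseteq> A" "|Field \<kappa>| =o |B|"
    unfolding internalize_card_of_ordLeq2[of "Field \<kappa>"] by blast
  then have "|B| =o \<kappa>"
    using card_of_Field_ordIso[OF assms(1)] ordIso_symmetric ordIso_transitive by blast
  with \<open>B \<subseteq> A\<close> assms(2) show False by blast
qed

lemma uncountable_if_natLeq_ordLess: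
  assumes "natLeq <o |A|"
  shows "uncountable A"
proof
  assume "countable A"
  then have "|A| \<le>o |UNIV :: nat set|"
    unfolding countable_def card_of_ordLeq[symmetric] by blast
  then have "|A| \<le>o natLeq"
    using card_of_nat ordLeq_ordIso_trans by blast
  with assms show False
    using not_ordLess_ordLeq by blast
qed

section \<open>Compact sets and K-Lusin sets in Baire space\<close>

text \<open>A box is a product of finite, hence compact, sets, so Tychonoff's theorem
  applies.\<close>

lemma compact_Baire_box:
  fixes h :: "nat \<Rightarrow> nat"
  shows "compactin Baire_space {x. \<forall>k. x k \<le> h k}"
proof -
  have "compactin (product_topology (\<lambda>k. euclidean) UNIV) (\<Pi>\<^sub>E k\<in>UNIV. {..h k})"
    unfolding compactin_PiE by (simp add: finite_imp_compact)
  moreover have "(\<Pi>\<^sub>E k\<in>UNIV. {..h k}) = {x. \<forall>k. x k \<le> h k}"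
    by auto
  ultimately show ?thesis
    by (simp add: euclidean_product_topology)
qed

text \<open>Each coordinate projection is continuous into a discrete space, where compact sets are
  finite; the maxima of the coordinates give the bound.\<close>

lemma compact_Baire_bounded:
  fixes K :: "(nat \<Rightarrow> nat) set"
  assumes "compactin Baire_space K"
  obtains h where "K \<subseteq> {x. \<forall>k. x k \<le> h k}"
proof
  have "finite ((\<lambda>x. x k) ` K)" for k
  proof -
    have "compact ((\<lambda>x. x k) ` K)"
      using assms continuous_on_subset[OF continuous_on_product_coordinates]
      by (intro compact_continuous_image) auto
    then have "compactin (discrete_topology UNIV) ((\<lambda>x. x k) ` K)"
      by (metis discrete_topology_unique open_discrete openin_subtopology compactin_euclidean_iff
          open_openin topspace_euclidean UNIV_I)
    then show ?thesis
      by (simp add: compactin_discrete_topology)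
  qed
  then show "K \<subseteq> {x. \<forall>k. x k \<le> Max ((\<lambda>x. x k) ` K)}"
    by auto
qed

lemma K_Lusin_in_Baire_iff:
  "K_Lusin_in \<kappa> Baire_space E \<longleftrightarrow> uncountable E \<and> box_small \<kappa> (\<lambda>x. x) E"
proof -
  have "(\<forall>K. compactin Baire_space K \<longrightarrow> |E \<inter> K| <o \<kappa>) \<longleftrightarrow> box_small \<kappa> (\<lambda>x. x) E"
  proof (intro iffI allI impI)
    assume *: "\<forall>K. compactin Baire_space K \<longrightarrow> |E \<inter> K| <o \<kappa>"
    show "box_small \<kappa> (\<lambda>x. x) E"
      unfolding box_small_def
    proof
      fix h
      show "|{x \<in> E. \<forall>k. x k \<le> h k}| <o \<kappa>"
        using *[rule_format, OF compact_Baire_box[of h]] by (simp add: Int_def)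
    qed
  next
    fix K assume *: "box_small \<kappa> (\<lambda>x. x) E" and "compactin Baire_space K"
    then obtain h where "K \<subseteq> {x. \<forall>k. x k \<le> h k}"
      using compact_Baire_bounded by blast
    then have "|E \<inter> K| \<le>o |{x \<in> E. \<forall>k. x k \<le> h k}|"
      by (intro card_of_mono1) auto
    with * show "|E \<inter> K| <o \<kappa>"
      unfolding box_small_def using ordLeq_ordLess_trans by blast
  qed
  then show ?thesis
    by (simp add: K_Lusin_in_def)
qed

text \<open>Shared final step of the routes from \<open>C9\<close> and from Polish spaces: an
  injective map dominating \<phi> turns E into a subset of Baire space of the same size.\<close>

lemma K_Lusin_in_Baire_if_box_small:
  fixes \<phi> :: "'a \<Rightarrow> nat \<Rightarrow> nat" and \<kappa> :: "'k rel" and \<mu> :: "'l rel"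
  assumes small: "box_small \<kappa> \<phi> E" and E: "|E| =o \<mu>"
    and "natLeq <o \<mu>" and "\<mu> \<le>o continuum"
  shows "\<exists>A. K_Lusin_in \<kappa> Baire_space A \<and> |A| =o \<mu>"
proof -
  have unc: "natLeq <o |E|"
    using assms(3) E ordIso_symmetric ordLess_ordIso_trans by blast
  have cont: "|E| \<le>o continuum"
    using E assms(4) by (rule ordIso_ordLeq_trans)
  obtain \<iota> :: "'a \<Rightarrow> nat set" where \<iota>: "inj_on \<iota> E"
    using inj_on_if_ordLeq_continuum cont continuum_ordIso_nat_sets ordIso_iff_ordLeq by metis
  \<comment> \<open>Storing the injective code \<open>\<iota>\<close> in the parities makes \<open>\<phi>\<close> injective and only increases it.\<close>
  define \<psi> where "\<psi> x k = 2 * \<phi> x k + of_bool (k \<in> \<iota> x)" for x k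
  have inj: "inj_on \<psi> E"
  proof (rule inj_onI)
    fix x y assume "x \<in> E" "y \<in> E" and eq: "\<psi> x = \<psi> y"
    have "k \<in> \<iota> z \<longleftrightarrow> odd (\<psi> z k)" for k z
      by (simp add: \<psi>_def)
    then have "\<iota> x = \<iota> y"
      by (auto simp: eq)
    with \<iota> \<open>x \<in> E\<close> \<open>y \<in> E\<close> show "x = y"
      by (simp add: inj_on_eq_iff)
  qed
  have "box_small \<kappa> (\<lambda>x. x) (\<psi> ` E)"
    unfolding box_small_def
  proof
    fix h :: "nat \<Rightarrow> nat"
    have le: "\<phi> x k \<le> \<psi> x k" for x k
      by (simp add: \<psi>_def)
    \<comment> \<open>Since \<phi> \<le> \<psi>, a point whose \<psi>-value lies in a box has its
      \<phi>-value in the same box.\<close>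
    have "{y \<in> \<psi> ` E. \<forall>k. y k \<le> h k} \<subseteq> \<psi> ` {x \<in> E. \<forall>k. \<phi> x k \<le> h k}"
      by (auto intro: order_trans[OF le])
    then have "|{y \<in> \<psi> ` E. \<forall>k. y k \<le> h k}| \<le>o |{x \<in> E. \<forall>k. \<phi> x k \<le> h k}|"
      by (rule ordLeq_transitive[OF card_of_mono1 card_of_image])
    with small show "|{y \<in> \<psi> ` E. \<forall>k. y k \<le> h k}| <o \<kappa>"
      unfolding box_small_def using ordLeq_ordLess_trans by blast
  qed
  moreover have "|\<psi> ` E| =o \<mu>"
    using card_of_inj_on_image[OF inj] E by (rule ordIso_transitive)
  moreover have "uncountable (\<psi> ` E)"
    using uncountable_if_natLeq_ordLess[OF unc] inj by (simp add: countable_image_inj_eq)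
  ultimately show ?thesis
    unfolding K_Lusin_in_Baire_iff by blast
qed

section \<open>Stages of pointwise convergence\<close>

lemma box_small_if_no_uniform_convergence:
  fixes f :: "nat \<Rightarrow> 'a \<Rightarrow> 'b :: metric_space" and \<kappa> :: "'k rel"
  assumes \<kappa>: "Card_order \<kappa>"
    and conv: "\<forall>x\<in>E. convergent (\<lambda>n. f n x)"
    and no_unif: "\<forall>S\<subseteq>E. |S| =o \<kappa> \<longrightarrow> \<not> uniformly_convergent_on S f"
  shows "\<exists>\<phi>. box_small \<kappa> \<phi> E"
proof -
  have "\<exists>N. \<forall>n\<ge>N. dist (f n x) (lim (\<lambda>n. f n x)) < inverse (real (Suc k))" if "x \<in> E" for x k
    using conv that by (simp add: convergent_LIMSEQ_iff lim_sequentially)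
  then obtain \<phi> where \<phi>:
    "\<And>x k n. x \<in> E \<Longrightarrow> n \<ge> \<phi> x k \<Longrightarrow> dist (f n x) (lim (\<lambda>n. f n x)) < inverse (real (Suc k))"
    by metis
  have "|{x \<in> E. \<forall>k. \<phi> x k \<le> h k}| <o \<kappa>" for h
  proof (rule ordLess_if_no_subset_ordIso[OF \<kappa>])
    fix S assume S: "S \<subseteq> {x \<in> E. \<forall>k. \<phi> x k \<le> h k}"
    \<comment> \<open>On S the stage \<open>h k\<close> dominates every \<open>\<phi> x k\<close>,
      so it serves all points at once for the tolerance \<open>1/(k+1)\<close>.\<close>
    have "uniform_limit S f (\<lambda>x. lim (\<lambda>n. f n x)) sequentially"
      unfolding uniform_limit_sequentially_iff
    proof (intro allI impI)
      fix e :: real assume "e > 0"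
      then obtain k where k: "inverse (real (Suc k)) < e"
        using reals_Archimedean by blast
      have "dist (f n x) (lim (\<lambda>n. f n x)) < e" if "n \<ge> h k" "x \<in> S" for n x
      proof -
        have "dist (f n x) (lim (\<lambda>n. f n x)) < inverse (real (Suc k))"
          using S that by (intro \<phi>) (auto intro: order_trans)
        with k show ?thesis by linarith
      qed
      then show "\<exists>N. \<forall>n\<ge>N. \<forall>x\<in>S. dist (f n x) (lim (\<lambda>n. f n x)) < e"
        by blast
    qed
    then show "\<not> |S| =o \<kappa>"
      using S no_unif uniformly_convergent_on_def by blast
  qed
  then show ?thesis
    unfolding box_small_def by blast
qed

section \<open>Polish spaces and total boundedness\<close>

context Metric_space
begin

text \<open>At each scale the finitely many points \<open>s i\<close> with
  \<open>i \<le> h k\<close> suffice as centres. As \<open>mtotally_bounded\<close> wants centres in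
  S, each \<open>s i\<close> that is used is replaced by a nearby point of S.\<close>

lemma mtotally_bounded_if_box:
  fixes s :: "nat \<Rightarrow> 'a"
  assumes "S \<subseteq> M" and box: "\<And>x k. x \<in> S \<Longrightarrow> \<exists>i\<le>h k. s i \<in> M \<and> d x (s i) < inverse (real (Suc k))"
  shows "mtotally_bounded S"
  unfolding mtotally_bounded_def
proof (intro allI impI)
  fix e :: real assume "e > 0"
  \<comment> \<open>Half of \<open>e\<close>, because the path from x to its new centre passes
    through \<open>s i\<close>.\<close>
  then obtain k where k: "inverse (real (Suc k)) < e / 2"
    using reals_Archimedean[of "e / 2"] by auto
  define I where "I = {i. i \<le> h k \<and> (\<exists>x\<in>S. s i \<in> M \<and> d x (s i) < inverse (real (Suc k)))}"
  then have "\<forall>i\<in>I. \<exists>x\<in>S. s i \<in> M \<and> d x (s i) < inverse (real (Suc k))"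
    by blast
  then obtain c where c: "\<And>i. i \<in> I \<Longrightarrow> c i \<in> S \<and> s i \<in> M \<and> d (c i) (s i) < inverse (real (Suc k))"
    by metis
  have "S \<subseteq> (\<Union>x\<in>c ` I. mball x e)"
  proof
    fix x assume "x \<in> S"
    then obtain i where i: "i \<le> h k" "s i \<in> M" "d x (s i) < inverse (real (Suc k))"
      using box by blast
    with \<open>x \<in> S\<close> have "i \<in> I"
      unfolding I_def by blast
    note ci = c[OF this]
    have "d (c i) x \<le> d (c i) (s i) + d (s i) x"
      using ci i \<open>x \<in> S\<close> assms(1) by (intro triangle) auto
    also have "\<dots> < e"
      using ci i k commute[of x "s i"] by linarith
    finally have "x \<in> mball (c i) e"
      using ci \<open>x \<in> S\<close> assms(1) by auto
    with \<open>i \<in> I\<close> show "x \<in> (\<Union>x\<in>c ` I. mball x e)"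
      by blast
  qed
  moreover have "finite (c ` I)"
    unfolding I_def by simp
  moreover have "c ` I \<subseteq> S"
    using c by blast
  ultimately show "\<exists>K. finite K \<and> K \<subseteq> S \<and> S \<subseteq> (\<Union>x\<in>K. mball x e)"
    by blast
qed

end

text \<open>In a complete metric, a totally bounded preimage of a box has compact closure, and E
  meets that closure in fewer than \<kappa> points.\<close>

lemma box_small_if_Polish:
  assumes "Polish_space X" and Lusin: "K_Lusin_in \<kappa> X E"
  shows "\<exists>\<phi>. box_small \<kappa> \<phi> E"
proof -
  obtain M d where "Metric_space M d" and complete: "Metric_space.mcomplete M d"
    and X: "X = Metric_space.mtopology M d"
    using assms(1) unfolding Polish_space_def completely_metrizable_space_def by blast
  then interpret Metric_space M d by simp
  obtain D where D: "countable D" "D \<subseteq> M" "mtopology closure_of D = M"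
    using assms(1) unfolding Polish_space_def separable_space_def X by auto
  have EM: "E \<subseteq> M" and "uncountable E"
    using Lusin by (auto simp: K_Lusin_in_def X)
  \<comment> \<open>Nonemptiness is what makes \<open>from_nat_into D\<close> enumerate exactly
    D.\<close>
  then have "M \<noteq> {}"
    by auto
  with D have "D \<noteq> {}"
    by auto
  define s where "s = from_nat_into D"
  have range_s: "range s = D"
    using D \<open>D \<noteq> {}\<close> by (simp add: s_def range_from_nat_into)
  have "\<exists>i. d x (s i) < inverse (real (Suc k))" if "x \<in> E" for x k
  proof -
    have "x \<in> mtopology closure_of D"
      using that EM D by auto
    moreover have "inverse (real (Suc k)) > 0"
      by simp
    ultimately have "\<exists>y\<in>D. y \<in> mball x (inverse (real (Suc k)))"
      unfolding metric_closure_of by blast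
    then obtain y where "y \<in> D" "d x y < inverse (real (Suc k))"
      by auto
    then show ?thesis
      using range_s by blast
  qed
  then obtain \<phi> where \<phi>: "\<And>x k. x \<in> E \<Longrightarrow> d x (s (\<phi> x k)) < inverse (real (Suc k))"
    by metis
  have "|{x \<in> E. \<forall>k. \<phi> x k \<le> h k}| <o \<kappa>" for h
  proof -
    let ?S = "{x \<in> E. \<forall>k. \<phi> x k \<le> h k}"
    have "\<exists>i\<le>h k. s i \<in> M \<and> d x (s i) < inverse (real (Suc k))" if "x \<in> ?S" for x k
      using that \<phi> range_s D(2) by blast
    with EM have "mtotally_bounded ?S"
      by (intro mtotally_bounded_if_box[of _ h s]) blast+
    then have "compactin X (mtopology closure_of ?S)"
      using mtotally_bounded_eq_compact_closure_of[OF complete] X by blast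
    then have "|E \<inter> mtopology closure_of ?S| <o \<kappa>"
      using Lusin unfolding K_Lusin_in_def by blast
    moreover have "?S \<subseteq> E \<inter> mtopology closure_of ?S"
      using closure_of_subset[of ?S mtopology] EM by auto
    ultimately show ?thesis
      using card_of_mono1 ordLeq_ordLess_trans by blast
  qed
  then show ?thesis
    unfolding box_small_def by blast
qed

section \<open>Truncation distances on Baire space\<close>

text \<open>The product metric is the series of \<open>2^-n * min (dist ...) 1\<close> over the
  coordinates, so it can be compared term by term; the geometric series gives summability.\<close>

lemma dist_fun_mono:
  fixes x y x' y' :: "'a :: countable \<Rightarrow> 'b :: metric_space"
  assumes "\<And>k. dist (x k) (y k) \<le> dist (x' k) (y' k)"
  shows "dist x y \<le> dist x' y'"
proof -
  have summable: "summable (\<lambda>n. (1/2)^n * min (dist (u (from_nat n)) (v (from_nat n))) 1)"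
    for u v :: "'a \<Rightarrow> 'b"
    by (rule summable_comparison_test'[of "\<lambda>n. (1/2)^n"]) (auto simp: summable_geometric_iff)
  show ?thesis
    unfolding dist_fun_def
    using assms by (intro suminf_le summable mult_left_mono min.mono) auto
qed

text \<open>One term of a convergent nonnegative series bounds the sum from below; this recovers a
  bound on a single coordinate from the metric.\<close>

lemma dist_fun_ge_term:
  fixes x y :: "'a :: countable \<Rightarrow> 'b :: metric_space"
  shows "(1/2) ^ to_nat k * min (dist (x k) (y k)) 1 \<le> dist x y"
proof -
  have summable: "summable (\<lambda>n. (1/2)^n * min (dist (x (from_nat n)) (y (from_nat n))) 1)"
    by (rule summable_comparison_test'[of "\<lambda>n. (1/2)^n"]) (auto simp: summable_geometric_iff)
  show ?thesis
    unfolding dist_fun_def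
    using sum_le_suminf[OF summable, of "{to_nat k}"] by simp
qed

text \<open>Truncation caps the values, not the length. A coordinate with \<open>x k > n\<close>
  changes by at least 1 and so contributes its full weight if \<open>n + 1 \<le> x k\<close>, while
  in general it changes by \<open>max (x k - n) 0\<close>.\<close>

definition truncation_dist :: "nat \<Rightarrow> (nat \<Rightarrow> nat) \<Rightarrow> real"
  where "truncation_dist n x = dist (\<lambda>k. real (x k)) (\<lambda>k. real (min (x k) n))"

lemma continuous_on_truncation_dist: "continuous_on A (truncation_dist n)"
proof -
  \<comment> \<open>Every real function on the discrete space of naturals is continuous.\<close>
  have "continuous_on A (\<lambda>x :: nat \<Rightarrow> nat. u (x k))" for u :: "nat \<Rightarrow> real" and k
    by (rule continuous_on_compose2[of UNIV u])
      (auto intro: continuous_on_subset[OF continuous_on_product_coordinates])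
  then show ?thesis
    unfolding truncation_dist_def
    by (intro continuous_on_dist continuous_on_coordinatewise_then_product)
qed

lemma decseq_truncation_dist: "decseq (\<lambda>n. truncation_dist n x)"
  unfolding truncation_dist_def
  by (intro decseq_SucI dist_fun_mono) (auto simp: dist_real_def)

text \<open>Coordinate k of the truncation is constant from n = \<open>x k\<close> on, and
  coordinatewise convergence is convergence in the product topology.\<close>

lemma truncation_dist_tendsto_0: "(\<lambda>n. truncation_dist n x) \<longlonglongrightarrow> 0"
proof -
  have "(\<lambda>n. real (min (x k) n)) \<longlonglongrightarrow> real (x k)" for k
  proof (rule tendsto_eventually)
    show "\<forall>\<^sub>F n in sequentially. real (min (x k) n) = real (x k)"
      using eventually_ge_at_top[of "x k"] by eventually_elim simp
  qed
  then have "limitin (product_topology (\<lambda>k. euclideanreal) UNIV)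
      (\<lambda>n k. real (min (x k) n)) (\<lambda>k. real (x k)) sequentially"
    unfolding limitin_componentwise by simp
  then have "(\<lambda>n k. real (min (x k) n)) \<longlonglongrightarrow> (\<lambda>k. real (x k))"
    by (simp add: euclidean_product_topology)
  from tendsto_dist[OF tendsto_const this, of "\<lambda>k. real (x k)"] show ?thesis
    unfolding truncation_dist_def by simp
qed

lemma bounded_if_uniformly_convergent_truncation_dist:
  assumes "uniformly_convergent_on S truncation_dist"
  obtains h where "S \<subseteq> {x. \<forall>k. x k \<le> h k}"
proof -
  obtain l where l: "uniform_limit S truncation_dist l sequentially"
    using assms uniformly_convergent_on_def by blast
  \<comment> \<open>The pointwise limit identifies the uniform limit as zero.\<close>
  have "l x = 0" if "x \<in> S" for x
    using tendsto_uniform_limitI[OF l that] truncation_dist_tendsto_0 LIMSEQ_unique by blast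
  then have lim: "\<exists>N. \<forall>n\<ge>N. \<forall>x\<in>S. truncation_dist n x < e" if "e > 0" for e
    using l that unfolding uniform_limit_sequentially_iff by (fastforce simp: dist_real_def)
  have "\<exists>n. \<forall>x\<in>S. x k \<le> n" for k
  proof -
    \<comment> \<open>The threshold is the full weight of coordinate k, so a point of S with
      \<open>x k > n\<close> would violate it. Thus n bounds coordinate k on S.\<close>
    obtain n where n: "\<forall>x\<in>S. truncation_dist n x < (1/2) ^ to_nat k"
      using lim[of "(1/2) ^ to_nat k"] by auto
    have "x k \<le> n" if "x \<in> S" for x
    proof (rule ccontr)
      assume "\<not> x k \<le> n"
      then have "min (dist (real (x k)) (real (min (x k) n))) 1 = 1"
        by (auto simp: dist_real_def)
      then have "(1/2) ^ to_nat k \<le> truncation_dist n x"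
        using dist_fun_ge_term[of k "\<lambda>k. real (x k)" "\<lambda>k. real (min (x k) n)"] by (simp add: truncation_dist_def)
      with n that show False
        by force
    qed
    then show ?thesis by blast
  qed
  then obtain h where "\<And>k x. x \<in> S \<Longrightarrow> x k \<le> h k"
    by metis
  then show ?thesis
    by (intro that[of h]) blast
qed

lemma no_uniform_truncation_dist_if_box_small:
  fixes \<kappa> :: "'k rel"
  assumes "box_small \<kappa> (\<lambda>x. x) A" and "S \<subseteq> A" and "|S| =o \<kappa>"
  shows "\<not> uniformly_convergent_on S truncation_dist"
proof
  assume "uniformly_convergent_on S truncation_dist"
  then obtain h where "S \<subseteq> {x. \<forall>k. x k \<le> h k}"
    using bounded_if_uniformly_convergent_truncation_dist by blast
  with assms(2) have "|S| \<le>o |{x \<in> A. \<forall>k. x k \<le> h k}|"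
    by (intro card_of_mono1) auto
  with assms(1) have "|S| <o \<kappa>"
    unfolding box_small_def using ordLeq_ordLess_trans by blast
  with assms(3) show False
    using not_ordLess_ordIso by blast
qed

section \<open>Transport of the sequence to the reals\<close>

text \<open>\<open>C9\<close> asks only for real-valued functions on a set of reals, so the sequence
  can be carried along any injection of A into the reals.\<close>

lemma C9_if_sequence:
  fixes A :: "'a set" and g :: "nat \<Rightarrow> 'a \<Rightarrow> real" and \<kappa> :: "'k rel" and \<mu> :: "'l rel"
  assumes A: "|A| =o \<mu>" and "\<mu> \<le>o continuum"
    and conv: "\<forall>x\<in>A. convergent (\<lambda>n. g n x)"
    and no_unif: "\<forall>S\<subseteq>A. |S| =o \<kappa> \<longrightarrow> \<not> uniformly_convergent_on S g"
  shows "C9 \<mu> \<kappa>"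
proof -
  have "|A| \<le>o continuum"
    using assms(1,2) by (rule ordIso_ordLeq_trans)
  then obtain e :: "'a \<Rightarrow> real" where e: "inj_on e A"
    using inj_on_if_ordLeq_continuum continuum_ordIso_reals ordIso_iff_ordLeq by metis
  define r where "r = inv_into A e"
  define f where "f n y = g n (r y)" for n y
  have r: "r (e x) = x" if "x \<in> A" for x
    using e that by (simp add: r_def)
  show ?thesis
    unfolding C9_def
  proof (intro exI conjI allI impI ballI)
    show "|e ` A| =o \<mu>"
      using card_of_inj_on_image[OF e] A ordIso_transitive by blast
    show "convergent (\<lambda>n. f n y)" if "y \<in> e ` A" for y
      using that conv r by (auto simp: f_def)
    fix S assume S: "S \<subseteq> e ` A" "|S| =o \<kappa>"
    have "inj_on r S"
      using S(1) unfolding r_def by (rule inj_on_inv_into)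
    then have "|r ` S| =o \<kappa>"
      using S(2) card_of_inj_on_image ordIso_transitive by blast
    moreover have "r ` S \<subseteq> A"
      using S(1) r by auto
    ultimately have "\<not> uniformly_convergent_on (r ` S) g"
      using no_unif by blast
    then show "\<not> uniformly_convergent_on S f"
    proof (rule contrapos_nn)
      assume "uniformly_convergent_on S f"
      then obtain l where "uniform_limit S f l sequentially"
        using uniformly_convergent_on_def by blast
      moreover have "f n (e x) = g n x" if "x \<in> r ` S" for n x
        using that \<open>r ` S \<subseteq> A\<close> r by (auto simp: f_def)
      moreover have "e x \<in> S" if "x \<in> r ` S" for x
        using that S(1) r by auto
      ultimately have "uniform_limit (r ` S) g (\<lambda>x. l (e x)) sequentially"
        unfolding uniform_limit_sequentially_iff by metis
      then show "uniformly_convergent_on (r ` S) g"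
        using uniformly_convergent_on_def by blast
    qed
  qed
qed

section \<open>Homeomorphic copies of Baire space\<close>

text \<open>A countable product of discrete spaces is completely metrizable, and a countable basis
  yields separability.\<close>

lemma Polish_Baire_space: "Polish_space Baire_space"
proof -
  obtain \<B> :: "(nat \<Rightarrow> nat) set set" where "countable \<B>" "topological_basis \<B>"
    using ex_countable_basis by blast
  then have "second_countable Baire_space"
    unfolding second_countable_def open_openin[symmetric]
    by (metis topological_basisE topological_basis_open)
  moreover have "euclidean = discrete_topology (UNIV :: nat set)"
    by (simp add: topology_eq open_discrete)
  then have "completely_metrizable_space (product_topology (\<lambda>_ :: nat. euclidean :: nat topology) UNIV)"
    by (simp add: completely_metrizable_space_product_topology
        completely_metrizable_space_discrete_topology)
  then have "completely_metrizable_space Baire_space"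
    by (simp add: euclidean_product_topology)
  ultimately show ?thesis
    by (simp add: Polish_space_def second_countable_imp_separable_space)
qed

lemma homeomorphic_copy:
  fixes Y :: "'a topology" and j :: "'a \<Rightarrow> 'b"
  assumes "inj j"
  obtains X where "homeomorphic_map Y X j"
proof
  \<comment> \<open>The target type may be larger than the range of j, so the topology is carried by
    that range only.\<close>
  let ?X = "pullback_topology (range j) (inv j) Y"
  have "homeomorphic_maps Y ?X j (inv j)"
    unfolding homeomorphic_maps_def
  proof (intro conjI)
    show "continuous_map Y ?X j"
      using assms by (intro continuous_map_pullback') (auto simp: continuous_map_eq comp_def)
    show "continuous_map ?X Y (inv j)"
      using continuous_map_pullback[of Y Y id "range j" "inv j"] by simp
  qed (use assms in \<open>auto simp: topspace_pullback_topology\<close>)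
  then show "homeomorphic_map Y ?X j"
    using homeomorphic_map_maps by blast
qed

lemma Polish_space_homeomorphic:
  assumes "Y homeomorphic_space X" and "Polish_space Y"
  shows "Polish_space X"
  using assms homeomorphic_completely_metrizable_space homeomorphic_separable_space
  unfolding Polish_space_def by blast

text \<open>The continuous inverse r sends a compact K to a compact set, and \<open>j\<close> E
  \<inter> K\<open>lies in the image under j of\<close>E \<inter> r \<open>K\<close>.\<close>

lemma K_Lusin_in_homeomorphic_image:
  assumes "homeomorphic_map Y X j" and Lusin: "K_Lusin_in \<kappa> Y E"
  shows "K_Lusin_in \<kappa> X (j ` E)"
proof -
  obtain r where r: "homeomorphic_maps Y X j r"
    using assms(1) homeomorphic_map_maps by blast
  then have inv: "\<And>x. x \<in> topspace Y \<Longrightarrow> r (j x) = x" and cont: "continuous_map X Y r"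
    and img: "j ` topspace Y \<subseteq> topspace X"
    by (auto simp: homeomorphic_maps_def continuous_map_def)
  have E: "E \<subseteq> topspace Y" and "uncountable E"
    using Lusin by (auto simp: K_Lusin_in_def)
  moreover have "inj_on j E"
    using inv E by (metis inj_onI subsetD)
  ultimately have "uncountable (j ` E)"
    by (simp add: countable_image_inj_eq)
  moreover have "|j ` E \<inter> K| <o \<kappa>" if "compactin X K" for K
  proof -
    have "compactin Y (r ` K)"
      using that cont by (rule image_compactin)
    then have "|E \<inter> r ` K| <o \<kappa>"
      using Lusin by (simp add: K_Lusin_in_def)
    moreover have "j ` E \<inter> K \<subseteq> j ` (E \<inter> r ` K)"
      using inv E by force
    ultimately show ?thesis
      by (meson card_of_image card_of_mono1 ordLeq_ordLess_trans)
  qed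
  ultimately show ?thesis
    using E img by (auto simp: K_Lusin_in_def)
qed

theorem theorem2p3:
  fixes \<kappa> :: "'k rel" and \<mu> :: "'l rel"
  assumes "Card_order \<kappa>" and "Card_order \<mu>"
    and "natLeq <o \<kappa>" and "\<kappa> \<le>o \<mu>" and "\<mu> \<le>o continuum"
    and large_type: "continuum \<le>o |UNIV :: 'x set|"
  shows
    "(C9 \<mu> \<kappa> \<longleftrightarrow>
       (\<exists>(A :: (nat \<Rightarrow> nat) set) (g :: nat \<Rightarrow> (nat \<Rightarrow> nat) \<Rightarrow> real).
          |A| =o \<mu> \<and>
          (\<forall>n. continuous_on A (g n)) \<and>
          (\<forall>x\<in>A. decseq (\<lambda>n. g n x)) \<and>
          (\<forall>x\<in>A. (\<lambda>n. g n x) \<longlonglongrightarrow> 0) \<and>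
          (\<forall>S\<subseteq>A. |S| =o \<kappa> \<longrightarrow> \<not> uniformly_convergent_on S g))) \<and>
     (C9 \<mu> \<kappa> \<longleftrightarrow>
       (\<exists>E. K_Lusin_in \<kappa> Baire_space E \<and> |E| =o \<mu>)) \<and>
     (C9 \<mu> \<kappa> \<longleftrightarrow>
       (\<exists>(X :: 'x topology) E. Polish_space X \<and> K_Lusin_in \<kappa> X E \<and> |E| =o \<mu>))"
    (is "(_ \<longleftrightarrow> ?seq) \<and> (_ \<longleftrightarrow> ?Baire) \<and> (_ \<longleftrightarrow> ?Polish)")
proof -
  have unc: "natLeq <o \<mu>"
    using assms(3,4) by (rule ordLess_ordLeq_trans)
  \<comment> \<open>The implications form the cycle \<open>C9\<close>, \<open>?Baire\<close>,
    \<open>?seq\<close>, \<open>C9\<close>; \<open>?Polish\<close> is joined to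
    \<open>?Baire\<close> in both directions.\<close>
  have "?Baire" if "C9 \<mu> \<kappa>"
  proof -
    obtain E :: "real set" and f :: "nat \<Rightarrow> real \<Rightarrow> real" where E: "|E| =o \<mu>"
      and "\<forall>x\<in>E. convergent (\<lambda>n. f n x)"
      and "\<forall>S\<subseteq>E. |S| =o \<kappa> \<longrightarrow> \<not> uniformly_convergent_on S f"
      using \<open>C9 \<mu> \<kappa>\<close> unfolding C9_def by blast
    then obtain \<phi> where "box_small \<kappa> \<phi> E"
      using box_small_if_no_uniform_convergence[OF assms(1)] by blast
    then show ?thesis
      using E unc assms(5) by (rule K_Lusin_in_Baire_if_box_small)
  qed
  moreover have "?seq" if "?Baire"
  proof -
    obtain A where "box_small \<kappa> (\<lambda>x. x) A" and "|A| =o \<mu>"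
      using \<open>?Baire\<close> unfolding K_Lusin_in_Baire_iff by blast
    then show ?thesis
      using continuous_on_truncation_dist decseq_truncation_dist truncation_dist_tendsto_0
        no_uniform_truncation_dist_if_box_small
      by (intro exI[of _ A] exI[of _ truncation_dist]) blast
  qed
  moreover have "C9 \<mu> \<kappa>" if "?seq"
  proof -
    obtain A :: "(nat \<Rightarrow> nat) set" and g :: "nat \<Rightarrow> (nat \<Rightarrow> nat) \<Rightarrow> real"
      where A: "|A| =o \<mu>" and "\<forall>x\<in>A. (\<lambda>n. g n x) \<longlonglongrightarrow> 0"
        and "\<forall>S\<subseteq>A. |S| =o \<kappa> \<longrightarrow> \<not> uniformly_convergent_on S g"
      using \<open>?seq\<close> by blast
    moreover from this have "\<forall>x\<in>A. convergent (\<lambda>n. g n x)"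
      using convergentI by blast
    ultimately show ?thesis
      using C9_if_sequence assms(5) by blast
  qed
  moreover have "?Polish" if "?Baire"
  proof -
    obtain E where E: "K_Lusin_in \<kappa> Baire_space E" "|E| =o \<mu>"
      using \<open>?Baire\<close> by blast
    \<comment> \<open>The size of \<open>'x\<close> leaves room for a copy of Baire space.\<close>
    obtain j :: "(nat \<Rightarrow> nat) \<Rightarrow> 'x" where "inj j"
      using inj_on_if_ordLeq_continuum[OF Baire_ordLeq_continuum large_type] by blast
    then obtain X where X: "homeomorphic_map Baire_space X j"
      using homeomorphic_copy by blast
    have "Polish_space X"
      using homeomorphic_map_imp_homeomorphic_space[OF X] Polish_Baire_space
      by (rule Polish_space_homeomorphic)
    moreover have "K_Lusin_in \<kappa> X (j ` E)"
      using X E(1) by (rule K_Lusin_in_homeomorphic_image)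
    moreover have "|j ` E| =o \<mu>"
      using card_of_inj_on_image[of j E] \<open>inj j\<close> E(2) inj_on_subset ordIso_transitive by blast
    ultimately show ?thesis by blast
  qed
  moreover have "?Baire" if "?Polish"
  proof -
    obtain X :: "'x topology" and E where "Polish_space X" "K_Lusin_in \<kappa> X E" and E: "|E| =o \<mu>"
      using \<open>?Polish\<close> by blast
    then obtain \<phi> where "box_small \<kappa> \<phi> E"
      using box_small_if_Polish by blast
    then show ?thesis
      using E unc assms(5) by (rule K_Lusin_in_Baire_if_box_small)
  qed
  ultimately show ?thesis by blast
qed

end
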